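(* Let $1<p<\infty$, and let $S$ be the unilateral shift on $\ell_p(\mathbb N_0)$, given by $Se_j=e_{j+1}$ for the standard basis $(e_j)_{j\ge0}$. Then $$W_e(S)=\overline{\mathbb D},\qquad W(S)=\mathbb D.$$ In particular, $W(S)\cap\mathbb T=\varnothing$ and $\overline{W(S)}=W_e(S)=\overline{\mathbb D}$.
   Context: $\mathbb N_0=\{0,1,2,\dots\}$, $\mathbb D=\{z\in\mathbb C:|z|<1\}$, $\mathbb T=\{z\in\mathbb C:|z|=1\}$; the bar denotes closure. With $1/p+1/q=1$, the dual of the complex space $\ell_p(\mathbb N_0)$ is identified with $\ell_q(\mathbb N_0)$ via $\langle x,y\rangle=\sum_j x_j\overline{y_j}$. For $x=(x_j)$ put $J(x)=(x_j|x_j|^{p-2})_j$ (with $0$ in the coordinates where $x_j=0$). For a bounded operator $T$ on $\ell_p(\mathbb N_0)$, the numerical range is $W(T)=\{\langle Tx,J(x)\rangle:\ \|x\|_p=1\}$, and the essential numerical range $W_e(T)$ is the set of all $\lambda\in\mathbb C$ for which there is a net (equivalently, a sequence) of unit vectors $x_\alpha$ with $x_\alpha\to0$ weakly and $\langle Tx_\alpha,J(x_\alpha)\rangle\to\lambda$. *)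

theory Defs
  imports "HOL-Analysis.Analysis"
begin

definition lp_space :: "real \<Rightarrow> (nat \<Rightarrow> complex) set" where
  "lp_space p = {x. summable (\<lambda>j. norm (x j) powr p)}"

definition lp_norm :: "real \<Rightarrow> (nat \<Rightarrow> complex) \<Rightarrow> real" where
  "lp_norm p x = (\<Sum>j. norm (x j) powr p) powr (1 / p)"

definition conj_exponent :: "real \<Rightarrow> real" where
  "conj_exponent p = p / (p - 1)"

lemma conj_exponent: "1 < p \<Longrightarrow> 1 / p + 1 / conj_exponent p = 1"
  by (simp add: conj_exponent_def field_simps)

definition pairing :: "(nat \<Rightarrow> complex) \<Rightarrow> (nat \<Rightarrow> complex) \<Rightarrow> complex" where
  "pairing x y = (\<Sum>j. x j * cnj (y j))"

definition unit_seq :: "nat \<Rightarrow> nat \<Rightarrow> complex" where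
  "unit_seq j = (\<lambda>i. if i = j then 1 else 0)"

text \<open>Operators are total functions on sequences; only their values on \<open>lp_space p\<close> matter.\<close>

definition bounded_operator :: "real \<Rightarrow> ((nat \<Rightarrow> complex) \<Rightarrow> (nat \<Rightarrow> complex)) \<Rightarrow> bool" where
  "bounded_operator p T \<longleftrightarrow>
     (\<forall>x\<in>lp_space p. T x \<in> lp_space p) \<and>
     (\<forall>x\<in>lp_space p. \<forall>y\<in>lp_space p. T (\<lambda>j. x j + y j) = (\<lambda>j. T x j + T y j)) \<and>
     (\<forall>c. \<forall>x\<in>lp_space p. T (\<lambda>j. c * x j) = (\<lambda>j. c * T x j)) \<and>
     (\<exists>C. \<forall>x\<in>lp_space p. lp_norm p (T x) \<le> C * lp_norm p x)"

definition duality_map :: "real \<Rightarrow> (nat \<Rightarrow> complex) \<Rightarrow> (nat \<Rightarrow> complex)" where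
  "duality_map p x = (\<lambda>j. if x j = 0 then 0 else x j * of_real (norm (x j) powr (p - 2)))"

definition numerical_range :: "real \<Rightarrow> ((nat \<Rightarrow> complex) \<Rightarrow> (nat \<Rightarrow> complex)) \<Rightarrow> complex set" where
  "numerical_range p T =
     {pairing (T x) (duality_map p x) | x. x \<in> lp_space p \<and> lp_norm p x = 1}"

text \<open>Weak convergence to 0, with the dual of \<open>\<ell>\<^sub>p\<close> identified with \<open>\<ell>\<^sub>q\<close> through \<^const>\<open>pairing\<close>.\<close>

definition weakly_null :: "real \<Rightarrow> (nat \<Rightarrow> nat \<Rightarrow> complex) \<Rightarrow> bool" where
  "weakly_null p X \<longleftrightarrow>
     (\<forall>y\<in>lp_space (conj_exponent p). (\<lambda>n. pairing (X n) y) \<longlonglongrightarrow> 0)"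

definition essential_numerical_range ::
  "real \<Rightarrow> ((nat \<Rightarrow> complex) \<Rightarrow> (nat \<Rightarrow> complex)) \<Rightarrow> complex set" where
  "essential_numerical_range p T =
     {l. \<exists>X. (\<forall>n. X n \<in> lp_space p \<and> lp_norm p (X n) = 1) \<and> weakly_null p X \<and>
             (\<lambda>n. pairing (T (X n)) (duality_map p (X n))) \<longlonglongrightarrow> l}"

text \<open>A bounded operator mapping each \<open>unit_seq j\<close> to \<open>unit_seq (Suc j)\<close> exists on every
  \<open>\<ell>\<^sub>p\<close> (it is unique there, by density of the finitely supported sequences).\<close>

lemma unilateral_shift_exists:
  fixes p :: real
  assumes "1 < p"
  shows "\<exists>S. bounded_operator p S \<and> (\<forall>j. S (unit_seq j) = unit_seq (Suc j))"
proof -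
  define S :: "(nat \<Rightarrow> complex) \<Rightarrow> (nat \<Rightarrow> complex)" where
    "S = (\<lambda>x j. case j of 0 \<Rightarrow> 0 | Suc i \<Rightarrow> x i)"
  have S0: "S x 0 = 0" and SS: "S x (Suc i) = x i" for x i
    by (simp_all add: S_def)
  have mem: "S x \<in> lp_space p" if "x \<in> lp_space p" for x
    using that summable_Suc_iff[of "\<lambda>j. norm (S x j) powr p"]
    by (simp add: lp_space_def SS)
  have nrm: "lp_norm p (S x) = lp_norm p x" if "x \<in> lp_space p" for x
    using suminf_split_head[of "\<lambda>j. norm (S x j) powr p"] mem[OF that]
    by (simp add: lp_space_def lp_norm_def S0 SS)
  have "bounded_operator p S"
    unfolding bounded_operator_def
  proof (intro conjI)
    show "\<exists>C. \<forall>x\<in>lp_space p. lp_norm p (S x) \<le> C * lp_norm p x"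
      by (rule exI[of _ 1]) (simp add: nrm)
    show "\<forall>x\<in>lp_space p. S x \<in> lp_space p"
      by (simp add: mem)
  qed (auto simp: S_def fun_eq_iff split: nat.splits)
  moreover have "\<forall>j. S (unit_seq j) = unit_seq (Suc j)"
    by (auto simp: S_def unit_seq_def fun_eq_iff split: nat.splits)
  ultimately show ?thesis by blast
qed

end

theory Submission
  imports Defs
begin

text \<open>
  On \<open>\<ell>\<^sub>p\<close> a bounded operator with \<open>S e\<^sub>j = e\<^bsub>j+1\<^esub>\<close> is the coordinate
  shift \<open>R\<close> (\<open>bounded_shift_eq_right_shift\<close>), so everything reduces to the numbers
  \<open>\<langle>R x, J x\<rangle>\<close> for unit vectors \<open>x\<close>.

  Why \<open>W(R)\<close> lies in the open disc: Young's inequality, applied coordinate by coordinate,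
  gives \<open>\<bar>\<langle>R x, J x\<rangle>\<bar> \<le> \<parallel>R x\<parallel>\<^sup>p/p + \<parallel>J x\<parallel>\<^sup>q/q = 1/p + 1/q = 1\<close>. At the first index where
  \<open>x\<close> does not vanish, \<open>R x\<close> vanishes and \<open>J x\<close> does not, so the inequality is strict there
  (\<open>norm_shift_form_less_1\<close>).

  Why every point \<open>l\<close> of the open disc is in \<open>W(R)\<close>: the geometric sequence with ratio
  \<open>cnj l\<close> is an eigenvector of the adjoint of \<open>R\<close>, the backward shift on \<open>\<ell>\<^sub>q\<close>, for the
  eigenvalue \<open>cnj l\<close>. If \<open>J x\<close> is a multiple of it and \<open>x\<close> is a unit vector, then
  \<open>\<langle>R x, J x\<rangle> = l \<langle>x, J x\<rangle> = l\<close> (\<open>shift_form_attains\<close>).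

  Why \<open>W\<^sub>e(R)\<close> is the closure of \<open>W(R)\<close>: points of \<open>W\<^sub>e(R)\<close> are limits of points of \<open>W(R)\<close>
  by definition. Conversely, replacing \<open>x\<close> by \<open>R\<^sup>n x\<close> changes neither the norm nor
  \<open>\<langle>R x, J x\<rangle>\<close>, and for arbitrary unit vectors \<open>x\<^sub>n\<close> the sequence \<open>R\<^sup>n x\<^sub>n\<close> is weakly null,
  because it only sees the tail of the functional from \<open>n\<close> on
  (\<open>weakly_null_shifted_units\<close>). So any convergent sequence of values in \<open>W(R)\<close> is also the
  value sequence of a weakly null sequence of unit vectors.
\<close>

section \<open>Pairings bounded by Young's inequality\<close>

lemma conj_exponent_gt_1: "1 < p \<Longrightarrow> 1 < conj_exponent p"
  by (simp add: conj_exponent_def field_simps)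

lemma lp_unit_iff_sums:
  assumes "1 < p"
  shows "x \<in> lp_space p \<and> lp_norm p x = 1 \<longleftrightarrow> (\<lambda>j. norm (x j) powr p) sums 1"
proof
  assume x: "x \<in> lp_space p \<and> lp_norm p x = 1"
  define s where "s = (\<Sum>j. norm (x j) powr p)"
  have sm: "summable (\<lambda>j. norm (x j) powr p)" using x by (simp add: lp_space_def)
  then have "0 \<le> s" unfolding s_def by (intro suminf_nonneg) auto
  then have "s = (s powr (1/p)) powr p" using assms by (simp add: powr_powr)
  also have "\<dots> = 1" using x by (simp add: lp_norm_def s_def)
  finally show "(\<lambda>j. norm (x j) powr p) sums 1"
    using summable_sums[OF sm] by (simp add: s_def)
next
  assume "(\<lambda>j. norm (x j) powr p) sums 1"
  then show "x \<in> lp_space p \<and> lp_norm p x = 1"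
    by (auto simp: lp_space_def lp_norm_def sums_iff)
qed

lemma norm_pairing_term_le:
  assumes "1 < p"
  shows "norm (x j * cnj (y j)) \<le> norm (x j) powr p / p + norm (y j) powr conj_exponent p / conj_exponent p"
  using Youngs_inequality[OF assms conj_exponent_gt_1[OF assms] conj_exponent[OF assms],
      of "norm (x j)" "norm (y j)"]
  by (simp add: norm_mult)

text \<open>
  Summing Young's inequality over the coordinates. The sum-of-powers form takes the place of
  Hoelder's inequality: it suffices once the vectors are scaled, and strictness at a single
  coordinate, where \<open>x\<close> vanishes and \<open>y\<close> does not, survives the summation.
\<close>

lemma
  assumes p: "1 < p" and x: "x \<in> lp_space p" and y: "y \<in> lp_space (conj_exponent p)"
  shows summable_norm_pairing: "summable (\<lambda>j. norm (x j * cnj (y j)))"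
    and norm_pairing_le: "norm (pairing x y) \<le> (\<Sum>j. norm (x j) powr p) / p
           + (\<Sum>j. norm (y j) powr conj_exponent p) / conj_exponent p"
    and norm_pairing_less: "\<lbrakk>x k = 0; y k \<noteq> 0\<rbrakk> \<Longrightarrow> norm (pairing x y) < (\<Sum>j. norm (x j) powr p) / p
           + (\<Sum>j. norm (y j) powr conj_exponent p) / conj_exponent p"
proof -
  define q where "q = conj_exponent p"
  have q: "1 < q" using conj_exponent_gt_1[OF p] by (simp add: q_def)
  define g where "g = (\<lambda>j. norm (x j) powr p / p + norm (y j) powr q / q)"
  have sx: "summable (\<lambda>j. norm (x j) powr p / p)" and sy: "summable (\<lambda>j. norm (y j) powr q / q)"
    using x y by (auto simp: lp_space_def q_def intro: summable_divide)
  have sg: "summable g" unfolding g_def by (intro summable_add sx sy)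
  have g: "suminf g = (\<Sum>j. norm (x j) powr p) / p + (\<Sum>j. norm (y j) powr q) / q"
    using x y unfolding g_def suminf_add[OF sx sy, symmetric]
    by (simp add: lp_space_def q_def suminf_divide)
  have le: "norm (x j * cnj (y j)) \<le> g j" for j
    unfolding g_def q_def by (rule norm_pairing_term_le[OF p])
  show sm: "summable (\<lambda>j. norm (x j * cnj (y j)))"
    by (rule summable_comparison_test'[OF sg, of 0]) (use le in auto)
  have n: "norm (pairing x y) \<le> (\<Sum>j. norm (x j * cnj (y j)))"
    unfolding pairing_def by (rule summable_norm[OF sm])
  also have "\<dots> \<le> suminf g" by (rule suminf_le[OF le sm sg])
  finally show "norm (pairing x y) \<le> (\<Sum>j. norm (x j) powr p) / p
           + (\<Sum>j. norm (y j) powr conj_exponent p) / conj_exponent p"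
    by (simp add: g q_def)
  show "norm (pairing x y) < (\<Sum>j. norm (x j) powr p) / p
           + (\<Sum>j. norm (y j) powr conj_exponent p) / conj_exponent p" if k: "x k = 0" "y k \<noteq> 0"
  proof -
    have "0 < (\<Sum>j. g j - norm (x j * cnj (y j)))"
    proof (rule suminf_pos2[of _ k])
      show "summable (\<lambda>j. g j - norm (x j * cnj (y j)))" by (rule summable_diff[OF sg sm])
    qed (use le k q in \<open>auto simp: g_def\<close>)
    also have "\<dots> = suminf g - (\<Sum>j. norm (x j * cnj (y j)))"
      by (rule suminf_diff[symmetric, OF sg sm])
    finally show ?thesis using n by (simp add: g q_def)
  qed
qed

lemma duality_map_powr:
  assumes "1 < p"
  shows "norm (duality_map p x j) powr conj_exponent p = norm (x j) powr p"
proof (cases "x j = 0")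
  case False
  have "norm (duality_map p x j) = norm (x j) powr 1 * norm (x j) powr (p - 2)"
    using False by (simp add: duality_map_def norm_mult)
  also have "\<dots> = norm (x j) powr (p - 1)" by (simp only: powr_add[symmetric]) simp
  finally show ?thesis using assms by (simp add: powr_powr conj_exponent_def)
qed (simp add: duality_map_def)

section \<open>The shift operator on sequences\<close>

definition right_shift :: "(nat \<Rightarrow> 'a::zero) \<Rightarrow> nat \<Rightarrow> 'a" where
  "right_shift x = (\<lambda>j. case j of 0 \<Rightarrow> 0 | Suc i \<Rightarrow> x i)"

lemma right_shift_simps [simp]: "right_shift x 0 = 0" "right_shift x (Suc i) = x i"
  by (simp_all add: right_shift_def)

lemma right_shift_funpow: "(right_shift ^^ n) x j = (if j < n then 0 else x (j - n))"
  by (induction n arbitrary: j) (auto simp: right_shift_def split: nat.splits)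

lemma sums_right_shift_iff:
  fixes f :: "nat \<Rightarrow> 'a::real_normed_vector"
  shows "right_shift f sums s \<longleftrightarrow> f sums s"
  using sums_Suc_iff[of "right_shift f" s] by simp

lemma right_shift_powr_sums_iff:
  "(\<lambda>j. norm (right_shift x j) powr p) sums s \<longleftrightarrow> (\<lambda>j. norm (x j) powr p) sums s"
proof -
  have "(\<lambda>j. norm (right_shift x j) powr p) = right_shift (\<lambda>j. norm (x j) powr p)"
    by (auto simp: right_shift_def split: nat.splits)
  then show ?thesis by (simp add: sums_right_shift_iff)
qed

text \<open>
  Shifting only inserts a zero term in front of the series, so this holds even for a divergent
  series, where both sums take the same unspecified value.
\<close>

lemma pairing_right_shift: "pairing (right_shift x) (right_shift y) = pairing x y"
proof -
  have "(\<lambda>j. right_shift x j * cnj (right_shift y j)) = right_shift (\<lambda>j. x j * cnj (y j))"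
    by (auto simp: right_shift_def split: nat.splits)
  then show ?thesis by (simp add: pairing_def suminf_def sums_right_shift_iff)
qed

lemma duality_map_right_shift: "duality_map p (right_shift x) = right_shift (duality_map p x)"
  by (auto simp: duality_map_def right_shift_def split: nat.splits)

lemma funpow_right_shift_lp_unit:
  assumes "1 < p" "x \<in> lp_space p" "lp_norm p x = 1"
  shows "(right_shift ^^ n) x \<in> lp_space p \<and> lp_norm p ((right_shift ^^ n) x) = 1"
proof -
  have "(\<lambda>j. norm ((right_shift ^^ n) x j) powr p) sums 1"
    by (induction n) (use assms lp_unit_iff_sums[OF assms(1)] in \<open>auto simp: right_shift_powr_sums_iff\<close>)
  then show ?thesis using lp_unit_iff_sums[OF assms(1)] by blast
qed

lemma pairing_duality_funpow_right_shift:
  "pairing (right_shift ((right_shift ^^ n) x)) (duality_map p ((right_shift ^^ n) x)) =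
   pairing (right_shift x) (duality_map p x)"
  by (induction n) (simp_all add: duality_map_right_shift pairing_right_shift)

lemma norm_le_lp_norm:
  assumes "1 < p" "x \<in> lp_space p"
  shows "norm (x i) \<le> lp_norm p x"
proof -
  have sm: "summable (\<lambda>j. norm (x j) powr p)" using assms by (simp add: lp_space_def)
  have "norm (x i) = (norm (x i) powr p) powr (1/p)" using assms by (simp add: powr_powr)
  also have "\<dots> \<le> lp_norm p x"
    unfolding lp_norm_def using assms sum_le_suminf[OF sm, of "{i}"]
    by (intro powr_mono2) auto
  finally show ?thesis .
qed

text \<open>
  Linearity determines \<open>S\<close> on the initial segments of \<open>x\<close>. The remaining tails tend to zero in
  norm, hence by boundedness so do their images, and each coordinate is dominated by the norm.
\<close>

lemma bounded_shift_eq_right_shift: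
  assumes p: "1 < p" and S: "bounded_operator p S" "\<And>j. S (unit_seq j) = unit_seq (Suc j)"
    and x: "x \<in> lp_space p"
  shows "S x = right_shift x"
proof
  fix i
  from S(1) obtain C where mem: "\<And>x. x \<in> lp_space p \<Longrightarrow> S x \<in> lp_space p"
    and add: "\<And>x y. x \<in> lp_space p \<Longrightarrow> y \<in> lp_space p \<Longrightarrow> S (\<lambda>j. x j + y j) = (\<lambda>j. S x j + S y j)"
    and scale: "\<And>c x. x \<in> lp_space p \<Longrightarrow> S (\<lambda>j. c * x j) = (\<lambda>j. c * S x j)"
    and C: "\<And>x. x \<in> lp_space p \<Longrightarrow> lp_norm p (S x) \<le> C * lp_norm p x"
    unfolding bounded_operator_def by blast
  define head where "head n = (\<lambda>j. if j < n then x j else 0)" for n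
  define tail where "tail n = (\<lambda>j. if j < n then 0 else x j)" for n
  have sm: "summable (\<lambda>j. norm (x j) powr p)" using x by (simp add: lp_space_def)
  have lp: "y \<in> lp_space p" if "\<And>j. norm (y j) \<le> norm (x j)" for y
    unfolding lp_space_def mem_Collect_eq
    by (rule summable_comparison_test'[OF sm, of 0]) (use that p in \<open>auto intro!: powr_mono2\<close>)
  have head_lp: "head n \<in> lp_space p" and tail_lp: "tail n \<in> lp_space p" for n
    by (rule lp; simp add: head_def tail_def)+
  have unit: "unit_seq n \<in> lp_space p" for n
    unfolding lp_space_def mem_Collect_eq
    by (rule summable_finite[of "{n}"]) (auto simp: unit_seq_def)
  have head: "S (head n) = right_shift (head n)" for n
  proof (induction n)
    case 0
    show ?case using scale[OF x, of 0] by (auto simp: head_def right_shift_def split: nat.splits)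
  next
    case (Suc n)
    have un: "(\<lambda>j. x n * unit_seq n j) \<in> lp_space p"
      by (rule lp) (simp add: unit_seq_def)
    have "head (Suc n) = (\<lambda>j. head n j + x n * unit_seq n j)"
      by (auto simp: head_def unit_seq_def less_Suc_eq)
    then have "S (head (Suc n)) = (\<lambda>j. right_shift (head n) j + x n * unit_seq (Suc n) j)"
      using add[OF head_lp un, of n] scale[OF unit, of "x n" n] S(2) Suc by simp
    also have "\<dots> = right_shift (head (Suc n))"
      by (auto simp: head_def unit_seq_def right_shift_def less_Suc_eq fun_eq_iff split: nat.splits)
    finally show ?case .
  qed
  have split: "S x i = right_shift (head n) i + S (tail n) i" for n
  proof -
    have "x = (\<lambda>j. head n j + tail n j)" by (auto simp: head_def tail_def)
    then have "S x = S (\<lambda>j. head n j + tail n j)" by (rule arg_cong)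
    then show ?thesis using add[OF head_lp tail_lp, of n n] head by simp
  qed
  have bound: "norm (S x i - right_shift x i) \<le> C * (\<Sum>j. norm (x (j + n)) powr p) powr (1/p)"
    if "i \<le> n" for n
  proof -
    have "right_shift (head n) i = right_shift x i"
      using that by (auto simp: right_shift_def head_def split: nat.splits)
    then have "norm (S x i - right_shift x i) = norm (S (tail n) i)" using split[of n] by simp
    also have "\<dots> \<le> C * lp_norm p (tail n)"
      using norm_le_lp_norm[OF p mem[OF tail_lp], of n i] C[OF tail_lp, of n] by simp
    also have "lp_norm p (tail n) = (\<Sum>j. norm (x (j + n)) powr p) powr (1/p)"
      using suminf_split_initial_segment[of "\<lambda>j. norm (tail n j) powr p" n] tail_lp[of n]
      by (simp add: lp_norm_def lp_space_def tail_def)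
    finally show ?thesis .
  qed
  have "(\<lambda>n. C * (\<Sum>j. norm (x (j + n)) powr p) powr (1/p)) \<longlonglongrightarrow> C * 0 powr (1/p)"
    by (intro tendsto_mult tendsto_powr2 tendsto_const suminf_exist_split2 sm)
       (use p in \<open>auto intro!: always_eventually suminf_nonneg summable_ignore_initial_segment sm\<close>)
  then have "norm (S x i - right_shift x i) \<le> C * 0 powr (1/p)"
    by (rule tendsto_lowerbound) (use bound in \<open>auto simp: eventually_sequentially\<close>)
  then show "S x i = right_shift x i" by simp
qed

section \<open>The numerical range of the shift\<close>

text \<open>
  Young's inequality bounds the form by \<open>1/p + 1/q = 1\<close>. The bound is strict at the first
  nonzero coordinate of \<open>x\<close>, where the shifted vector is still zero.
\<close>

lemma norm_shift_form_less_1: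
  assumes p: "1 < p" and x: "x \<in> lp_space p" "lp_norm p x = 1"
  shows "norm (pairing (right_shift x) (duality_map p x)) < 1"
proof -
  have s: "(\<lambda>j. norm (x j) powr p) sums 1" using x lp_unit_iff_sums[OF p] by blast
  have "\<exists>k. x k \<noteq> 0"
  proof (rule ccontr)
    assume "\<nexists>k. x k \<noteq> 0"
    then show False using sums_unique2[OF s, of 0] by simp
  qed
  define k where "k = (LEAST k. x k \<noteq> 0)"
  have k: "x k \<noteq> 0" unfolding k_def using \<open>\<exists>k. x k \<noteq> 0\<close> by (rule LeastI_ex)
  have k': "right_shift x k = 0"
    using not_less_Least[of _ "\<lambda>k. x k \<noteq> 0", folded k_def]
    by (auto simp: right_shift_def split: nat.splits)
  have s': "(\<lambda>j. norm (right_shift x j) powr p) sums 1"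
    using s by (simp add: right_shift_powr_sums_iff)
  have J: "duality_map p x \<in> lp_space (conj_exponent p)"
    using x by (simp add: lp_space_def duality_map_powr[OF p])
  have "duality_map p x k \<noteq> 0" using k by (simp add: duality_map_def)
  then have "norm (pairing (right_shift x) (duality_map p x)) < 1 / p + 1 / conj_exponent p"
    using norm_pairing_less[of p "right_shift x" "duality_map p x" k] J k' s s' p
    by (auto simp: lp_space_def duality_map_powr[OF p] sums_iff)
  then show ?thesis by (simp add: conj_exponent[OF p])
qed

text \<open>
  The witness is the unit vector \<open>x\<close> for which \<open>J x\<close> is proportional to the geometric
  sequence with ratio \<open>cnj l\<close>, an eigenvector of the adjoint of the shift.
\<close>

lemma shift_form_attains:
  assumes p: "1 < p" and l: "norm l < 1"
  shows "\<exists>x. x \<in> lp_space p \<and> lp_norm p x = 1 \<and> pairing (right_shift x) (duality_map p x) = l"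
proof -
  \<comment> \<open>The ratio of \<open>x\<close>: the solution of \<open>w \<bar>w\<bar>\<^bsup>p-2\<^esup> = cnj l\<close>, so that \<open>J x\<close> has ratio \<open>cnj l\<close>.\<close>
  define w where "w = cnj l * of_real (norm l powr (1/(p-1) - 1))"
  have nw: "norm w = norm l powr (1/(p-1))"
    by (auto simp: w_def norm_mult norm_divide powr_diff)
  define r where "r = norm w powr p"
  have r: "0 \<le> r" "r < 1"
    using l p powr_less_mono2[of "p / (p - 1)" "norm l" 1] by (auto simp: r_def nw powr_powr)
  \<comment> \<open>The \<open>p\<close>-th powers of \<open>\<bar>w\<bar>\<^sup>j\<close> sum to \<open>1/(1 - r)\<close>; the factor \<open>c\<close> normalises \<open>x\<close>.\<close>
  define c where "c = (1 - r) powr (1/p)"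
  have c: "0 < c" "c powr p = 1 - r"
    using r p by (auto simp: c_def powr_powr)
  define x where "x = (\<lambda>j::nat. of_real c * w ^ j)"
  have x_powr: "norm (x j) powr p = (1 - r) * r ^ j" for j
  proof -
    have "(norm w ^ j) powr p = r ^ j"
      by (induction j) (simp_all add: r_def powr_mult)
    then show ?thesis using c by (simp add: x_def norm_mult norm_power powr_mult)
  qed
  have geo: "(\<lambda>j. (1 - r) * r ^ j) sums 1"
    using sums_mult[OF geometric_sums[of r], of "1 - r"] r by simp
  have unit: "x \<in> lp_space p \<and> lp_norm p x = 1"
    using lp_unit_iff_sums[OF p] geo by (simp add: x_powr)
  have "(\<lambda>j. right_shift x j * cnj (duality_map p x j)) sums (l * 1)"
  proof -
    have "x j * cnj (duality_map p x (Suc j)) = l * of_real ((1 - r) * r ^ j)" for j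
    proof (cases "l = 0")
      case True
      then show ?thesis by (simp add: w_def x_def duality_map_def)
    next
      case False
      then have "w \<noteq> 0" by (simp add: w_def)
      have xz: "x j \<noteq> 0" using \<open>w \<noteq> 0\<close> c by (simp add: x_def)
      have xS: "x (Suc j) = w * x j" by (simp add: x_def)
      have wl: "cnj w * of_real (norm w powr (p - 2)) = l"
      proof -
        have "norm l powr (1/(p-1) - 1) * norm w powr (p - 2) = norm l powr 0"
          unfolding nw powr_powr powr_add[symmetric]
          using p by (intro arg_cong[of _ _ "\<lambda>t. norm l powr t"]) (simp add: field_simps)
        then show ?thesis using False by (simp add: w_def flip: of_real_mult)
      qed
      have "norm (x j) ^ 2 * norm (x j) powr (p - 2) = norm (x j) powr p"
        using xz by (simp add: powr_diff)
      then have "x j * cnj (x j) * of_real (norm (x j) powr (p - 2)) = of_real (norm (x j) powr p)"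
        by (simp add: complex_norm_square[symmetric] flip: of_real_power of_real_mult)
      then show ?thesis
        using wl[symmetric] xz \<open>w \<noteq> 0\<close>
        by (simp add: duality_map_def xS norm_mult powr_mult x_powr mult_ac)
    qed
    then have "(\<lambda>j. x j * cnj (duality_map p x (Suc j))) sums (l * of_real 1)"
      using sums_mult[OF sums_of_real[OF geo], of l] by simp
    then show ?thesis
      using sums_Suc_iff[of "\<lambda>j. right_shift x j * cnj (duality_map p x j)"] by simp
  qed
  then have "pairing (right_shift x) (duality_map p x) = l"
    by (simp add: pairing_def sums_iff)
  then show ?thesis using unit by blast
qed

lemma numerical_range_shift:
  assumes p: "1 < p" and S: "\<And>x. x \<in> lp_space p \<Longrightarrow> S x = right_shift x"
  shows "numerical_range p S = ball 0 1"
proof (intro equalityI subsetI)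
  fix l assume "l \<in> numerical_range p S"
  then show "l \<in> ball 0 1"
    using norm_shift_form_less_1[OF p] S by (auto simp: numerical_range_def)
next
  fix l :: complex assume "l \<in> ball 0 1"
  then obtain x where "x \<in> lp_space p" "lp_norm p x = 1" "pairing (right_shift x) (duality_map p x) = l"
    using shift_form_attains[OF p, of l] by auto
  then show "l \<in> numerical_range p S"
    using S unfolding numerical_range_def by force
qed

section \<open>The essential numerical range of the shift\<close>

text \<open>
  Pairing \<open>R\<^sup>n x\<^sub>n\<close> with \<open>y\<close> amounts to pairing \<open>x\<^sub>n\<close> with the tail of \<open>y\<close> from \<open>n\<close> on,
  whose \<open>q\<close>-norm tends to zero; the bound is uniform over all unit vectors, so the \<open>x\<^sub>n\<close> need
  not be related to each other.
\<close>

lemma weakly_null_shifted_units: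
  assumes p: "1 < p" and X: "\<And>n. X n \<in> lp_space p" "\<And>n. lp_norm p (X n) = 1"
  shows "weakly_null p (\<lambda>n. (right_shift ^^ n) (X n))"
  unfolding weakly_null_def
proof
  define q where "q = conj_exponent p"
  have q: "1 < q" using conj_exponent_gt_1[OF p] by (simp add: q_def)
  fix y assume y: "y \<in> lp_space (conj_exponent p)"
  then have sm: "summable (\<lambda>j. norm (y j) powr q)" by (simp add: lp_space_def q_def)
  show "(\<lambda>n. pairing ((right_shift ^^ n) (X n)) y) \<longlonglongrightarrow> 0"
  proof (rule tendstoI)
    fix e :: real assume e: "0 < e"
    have "(\<lambda>n. \<Sum>j. norm (y (j + n)) powr q) \<longlonglongrightarrow> 0" by (rule suminf_exist_split2[OF sm])
    then have "eventually (\<lambda>n. (\<Sum>j. norm (y (j + n)) powr q) < e powr q) sequentially"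
      using e by (intro order_tendstoD) auto
    then show "eventually (\<lambda>n. dist (pairing ((right_shift ^^ n) (X n)) y) 0 < e) sequentially"
    proof eventually_elim
      case (elim n)
      define B where "B = (\<Sum>j. norm (y (j + n)) powr q)"
      \<comment> \<open>Once the tail of \<open>y\<close> is divided by \<open>e\<close>, its \<open>q\<close>-norm is below \<open>1\<close>, and Young's
        inequality alone bounds its pairing with a unit vector by \<open>1\<close>.\<close>
      define z where "z = (\<lambda>j. y (j + n) / of_real e)"
      have smt: "summable (\<lambda>j. norm (y (j + n)) powr q)"
        using sm by (rule summable_ignore_initial_segment)
      have z_powr: "norm (z j) powr q = norm (y (j + n)) powr q / e powr q" for j
        using e by (simp add: z_def norm_divide powr_divide)
      have z: "z \<in> lp_space (conj_exponent p)"
        using smt by (simp add: lp_space_def z_powr summable_divide flip: q_def)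
      have zB: "(\<Sum>j. norm (z j) powr q) = B / e powr q"
        using suminf_divide[OF smt] by (simp add: z_powr B_def)
      have X1: "(\<Sum>j. norm (X n j) powr p) = 1"
        using lp_unit_iff_sums[OF p, of "X n"] X by (simp add: sums_iff)
      have "(\<lambda>j. X n j * cnj (z j)) sums pairing (X n) z"
        unfolding pairing_def
        by (rule summable_sums[OF summable_norm_cancel[OF summable_norm_pairing[OF p X(1) z]]])
      then have "(\<lambda>j. of_real e * (X n j * cnj (z j))) sums (of_real e * pairing (X n) z)"
        by (rule sums_mult)
      then have "(\<lambda>j. X n j * cnj (y (j + n))) sums (of_real e * pairing (X n) z)"
        using e by (simp add: z_def)
      then have "(\<lambda>j. (right_shift ^^ n) (X n) (j + n) * cnj (y (j + n))) sums (of_real e * pairing (X n) z)"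
        by (simp add: right_shift_funpow)
      then have "(\<lambda>j. (right_shift ^^ n) (X n) j * cnj (y j)) sums (of_real e * pairing (X n) z)"
        using sums_iff_shift[of "\<lambda>j. (right_shift ^^ n) (X n) j * cnj (y j)" n]
        by (simp add: right_shift_funpow)
      then have "pairing ((right_shift ^^ n) (X n)) y = of_real e * pairing (X n) z"
        by (simp add: pairing_def sums_iff)
      moreover have "norm (pairing (X n) z) < 1"
      proof -
        have "norm (pairing (X n) z) \<le> 1 / p + (B / e powr q) / q"
          using norm_pairing_le[OF p X(1) z, of n] by (simp add: X1 zB flip: q_def)
        also have "\<dots> < 1 / p + 1 / q"
          using elim e q by (intro add_strict_left_mono divide_strict_right_mono) (auto simp: B_def)
        finally show ?thesis using conj_exponent[OF p] by (simp add: q_def)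
      qed
      ultimately show ?case using e by (simp add: norm_mult)
    qed
  qed
qed

lemma essential_numerical_range_shift:
  assumes p: "1 < p" and S: "\<And>x. x \<in> lp_space p \<Longrightarrow> S x = right_shift x"
  shows "essential_numerical_range p S = closure (numerical_range p S)"
proof (intro equalityI subsetI)
  fix l assume "l \<in> essential_numerical_range p S"
  then obtain X where "\<And>n. X n \<in> lp_space p \<and> lp_norm p (X n) = 1"
    and "(\<lambda>n. pairing (S (X n)) (duality_map p (X n))) \<longlonglongrightarrow> l"
    unfolding essential_numerical_range_def by blast
  then show "l \<in> closure (numerical_range p S)"
    unfolding closure_sequential numerical_range_def
    by (intro exI[of _ "\<lambda>n. pairing (S (X n)) (duality_map p (X n))"]) blast
next
  fix l assume "l \<in> closure (numerical_range p S)"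
  then obtain f where f: "\<And>n. f n \<in> numerical_range p S" "f \<longlonglongrightarrow> l"
    unfolding closure_sequential by blast
  then have "\<forall>n. \<exists>x. x \<in> lp_space p \<and> lp_norm p x = 1 \<and> f n = pairing (S x) (duality_map p x)"
    unfolding numerical_range_def by blast
  then obtain X where X: "\<And>n. X n \<in> lp_space p" "\<And>n. lp_norm p (X n) = 1"
    and fX: "\<And>n. f n = pairing (S (X n)) (duality_map p (X n))"
    by metis
  \<comment> \<open>Moving the \<open>n\<close>-th vector \<open>n\<close> places to the right makes the sequence weakly null and
    preserves all values.\<close>
  define Y where "Y n = (right_shift ^^ n) (X n)" for n
  have Y: "Y n \<in> lp_space p \<and> lp_norm p (Y n) = 1" for n
    unfolding Y_def by (rule funpow_right_shift_lp_unit[OF p X])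
  have "pairing (S (Y n)) (duality_map p (Y n)) = f n" for n
    using S Y[of n] X(1)[of n] pairing_duality_funpow_right_shift[of n "X n" p]
    by (simp add: fX Y_def)
  then have "(\<lambda>n. pairing (S (Y n)) (duality_map p (Y n))) \<longlonglongrightarrow> l"
    using f(2) by simp
  moreover have "weakly_null p Y"
    unfolding Y_def by (rule weakly_null_shifted_units[OF p X])
  ultimately show "l \<in> essential_numerical_range p S"
    unfolding essential_numerical_range_def using Y by blast
qed

theorem proposition4p14:
  fixes p :: real and S :: "(nat \<Rightarrow> complex) \<Rightarrow> (nat \<Rightarrow> complex)"
  assumes "1 < p"
    and "bounded_operator p S"
    and "\<And>j. S (unit_seq j) = unit_seq (Suc j)"
  shows "essential_numerical_range p S = closure (ball 0 1) \<and>
         numerical_range p S = ball 0 1 \<and>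
         numerical_range p S \<inter> sphere 0 1 = {} \<and>
         closure (numerical_range p S) = essential_numerical_range p S \<and>
         essential_numerical_range p S = closure (ball 0 1)"
proof -
  have S: "S x = right_shift x" if "x \<in> lp_space p" for x
    using bounded_shift_eq_right_shift[OF assms that] .
  have "numerical_range p S = ball 0 1"
    by (rule numerical_range_shift[OF assms(1) S])
  moreover have "essential_numerical_range p S = closure (numerical_range p S)"
    by (rule essential_numerical_range_shift[OF assms(1) S])
  ultimately show ?thesis by auto
qed

end
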